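(* Let $I\subset\mathbb{R}$ be a compact interval, let $\Delta\subset I$ be a finite union of open intervals with pairwise disjoint closures, and let $f\colon I\to I$ be a map of class $C^1$ on $I\setminus\Delta$. Let $[x_1,x_2]\subset I\setminus\Delta$ and let $n>0$ be an integer. Suppose that the algorithm PeriodicOrbit (described in the context) applied to $f,\Delta,[x_1,x_2],n$ does not return $\emptyset$, and let $\lambda_{\max}$ be the number it returns. Then there exists exactly one periodic orbit of period $n$ of $f$ that passes through a point $x$ in the interior of $[x_1,x_2]$. Moreover, $$|(f^n)'(x)|\le e^{\lambda_{\max}n}.$$ As a consequence, if $f$ is uniformly expanding outside $\Delta$, then any constant $\lambda>0$ for which there is a constant $C>0$ such that $|(f^m)'(y)|\ge Ce^{\lambda m}$ for all $m\ge1$ and all $y\in I$ with $f^i(y)\notin\Delta$ for $i=0,\dots,m-1$, must satisfy $\lambda\le\lambda_{\max}$.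
   Context: Uniform expansion: $f$ is uniformly expanding outside $\Delta$ if there are constants $C,\lambda>0$ such that for every $y\in I$ and $m\ge1$ with $f^i(y)\notin\Delta$ for all $i=0,\dots,m-1$, one has $|(f^m)'(y)|\ge Ce^{\lambda m}$. A periodic orbit of period $n$ through $x$ means the orbit of a point $x$ with $f^n(x)=x$ ($n$ is not required to be the least period). Algorithm PeriodicOrbit (input: $f$, $\Delta$, $[x_1,x_2]\subset I\setminus\Delta$, integer $n>0$). Put $x_0=(x_1+x_2)/2$ and $g(x)=x-f^n(x)$. All intervals below are compact intervals computed by interval arithmetic that are rigorous enclosures of the indicated quantities. 1. Compute intervals $F^n_{x_0}$ containing $f^n(x_0)$; $G_{x_0}$ containing $g(x_0)$; $(F^n_x)'$ containing $(f^n)'(x)$ for all $x\in[x_1,x_2]$; and $G'_x$ containing $g'(x)=1-(f^n)'(x)$ for all $x\in[x_1,x_2]$. 2. If $0\in G'_x$, return $\emptyset$. 3. Compute an interval $N_x$ containing $x_0-g(x_0)/g'(x)$ for all $x\in[x_1,x_2]$ (namely an enclosure of $x_0-G_{x_0}/G'_x$). If $N_x$ is not contained in the interior of $[x_1,x_2]$, return $\emptyset$. 4. If $0\in(F^n_x)'$, return $\emptyset$. 5. Compute intervals $F^i_x$ containing $f^i([x_1,x_2])$ for $i=1,\dots,n$. If $F^i_x\cap\Delta\ne\emptyset$ for some $i\in\{1,\dots,n\}$, return $\emptyset$. 6. Compute and return a number $\lambda_{\max}$ that is an upper bound on $\ln(|(f^n)'(x)|)/n$ for all $x\in[x_1,x_2]$.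 *)

theory Defs
  imports "HOL-Analysis.Analysis" "HOL-Library.Interval"
begin

definition open_interval_union :: "real set \<Rightarrow> bool" where
  "open_interval_union \<Delta> \<longleftrightarrow>
     (\<exists>\<J>. finite \<J> \<and> \<Delta> = \<Union>\<J> \<and>
        (\<forall>J\<in>\<J>. \<exists>u v. u < v \<and> J = {u<..<v}) \<and>
        pairwise (\<lambda>J K. closure J \<inter> closure K = {}) \<J>)"

text \<open>The set \<open>S\<close> will be \<open>I - \<Delta>\<close>, which is not open: derivatives at its boundary points are taken
  within \<open>S\<close> (one-sided), so nothing is required of \<open>f\<close> inside \<open>\<Delta>\<close> or outside \<open>I\<close>. This is weaker
  than \<^const>\<open>C1_differentiable_on\<close>, which uses two-sided derivatives at all points.\<close>

definition C1_within :: "(real \<Rightarrow> real) \<Rightarrow> real set \<Rightarrow> bool" where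
  "C1_within f S \<longleftrightarrow>
     (\<exists>f'. continuous_on S f' \<and> (\<forall>x\<in>S. (f has_real_derivative f' x) (at x within S)))"

definition iterate_domain :: "real set \<Rightarrow> real set \<Rightarrow> (real \<Rightarrow> real) \<Rightarrow> nat \<Rightarrow> real set" where
  "iterate_domain I \<Delta> f m = {y \<in> I. \<forall>i<m. (f ^^ i) y \<notin> \<Delta>}"

text \<open>\<open>has_iterate_deriv I \<Delta> f m y d\<close> says that \<open>(f\<^sup>m)'(y)\<close> is defined and equals \<open>d\<close>. As \<open>f\<close> is only
  controlled on \<open>I - \<Delta>\<close>, the difference quotients are restricted to the set where the orbit avoids
  \<open>\<Delta>\<close> for the first \<open>m\<close> steps; at interior points of that set this is the usual derivative.
  At an isolated point of that set every number would be a derivative in the sense of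
  \<^const>\<open>has_real_derivative\<close>, so such points are excluded and \<open>d\<close> is unique.\<close>

definition has_iterate_deriv ::
  "real set \<Rightarrow> real set \<Rightarrow> (real \<Rightarrow> real) \<Rightarrow> nat \<Rightarrow> real \<Rightarrow> real \<Rightarrow> bool" where
  "has_iterate_deriv I \<Delta> f m y d \<longleftrightarrow>
     y \<in> iterate_domain I \<Delta> f m \<and> y islimpt iterate_domain I \<Delta> f m \<and>
     ((f ^^ m) has_real_derivative d) (at y within iterate_domain I \<Delta> f m)"

definition expanding_with ::
  "real set \<Rightarrow> real set \<Rightarrow> (real \<Rightarrow> real) \<Rightarrow> real \<Rightarrow> real \<Rightarrow> bool" where
  "expanding_with I \<Delta> f C l \<longleftrightarrow>
     (\<forall>m\<ge>1. \<forall>y\<in>I. (\<forall>i<m. (f ^^ i) y \<notin> \<Delta>) \<longrightarrow>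
        (\<forall>d. has_iterate_deriv I \<Delta> f m y d \<longrightarrow> \<bar>d\<bar> \<ge> C * exp (l * real m)))"

definition uniformly_expanding :: "real set \<Rightarrow> real set \<Rightarrow> (real \<Rightarrow> real) \<Rightarrow> bool" where
  "uniformly_expanding I \<Delta> f \<longleftrightarrow> (\<exists>C>0. \<exists>l>0. expanding_with I \<Delta> f C l)"

definition forward_orbit :: "(real \<Rightarrow> real) \<Rightarrow> real \<Rightarrow> real set" where
  "forward_orbit f x = range (\<lambda>k. (f ^^ k) x)"

text \<open>The number \<open>n\<close> need not be the least period.\<close>

definition periodic_orbit_through :: "(real \<Rightarrow> real) \<Rightarrow> nat \<Rightarrow> real \<Rightarrow> real set \<Rightarrow> bool" where
  "periodic_orbit_through f n x Q \<longleftrightarrow> (f ^^ n) x = x \<and> Q = forward_orbit f x"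

text \<open>The algorithm as a relation between its input and a possible output \<open>r\<close>, where \<^term>\<open>None\<close>
  stands for the answer \<open>\<emptyset>\<close>. Interval arithmetic is nondeterministic: any compact intervals that
  rigorously enclose the indicated quantities may be computed (elements of type
  \<^typ>\<open>real interval\<close> are nonempty and compact). The names correspond as follows:
  \<open>Fx0\<close> encloses \<open>f\<^sup>n(x\<^sub>0)\<close>, \<open>Gx0\<close> encloses \<open>g(x\<^sub>0)\<close>, \<open>DF\<close> encloses \<open>(f\<^sup>n)'\<close> and \<open>DG\<close> encloses
  \<open>g' = 1 - (f\<^sup>n)'\<close> on \<open>[x\<^sub>1,x\<^sub>2]\<close>, \<open>N\<close> encloses \<open>x\<^sub>0 - Gx0 / DG\<close>, and \<open>F i\<close> encloses \<open>f\<^sup>i([x\<^sub>1,x\<^sub>2])\<close>.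
  Whether the orbits of all points of \<open>[x\<^sub>1,x\<^sub>2]\<close> avoid \<open>\<Delta>\<close> is tested only in the fifth step, so the
  enclosures of derivatives are required wherever the derivative is defined.\<close>

definition PeriodicOrbit ::
  "real set \<Rightarrow> (real \<Rightarrow> real) \<Rightarrow> real set \<Rightarrow> real \<Rightarrow> real \<Rightarrow> nat \<Rightarrow> real option \<Rightarrow> bool" where
  "PeriodicOrbit I f \<Delta> x1 x2 n r \<longleftrightarrow>
    (let x0 = (x1 + x2) / 2; g = (\<lambda>x. x - (f ^^ n) x) in
     \<exists>Fx0 Gx0 DF DG :: real interval.
       (f ^^ n) x0 \<in> set_of Fx0 \<and>
       g x0 \<in> set_of Gx0 \<and>
       (\<forall>x\<in>{x1..x2}. \<forall>d. has_iterate_deriv I \<Delta> f n x d \<longrightarrow> d \<in> set_of DF) \<and>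
       (\<forall>x\<in>{x1..x2}. \<forall>d. has_iterate_deriv I \<Delta> f n x d \<longrightarrow> 1 - d \<in> set_of DG) \<and>
       (if 0 \<in> set_of DG then r = None
        else \<exists>N :: real interval.
          (\<forall>u\<in>set_of Gx0. \<forall>v\<in>set_of DG. x0 - u / v \<in> set_of N) \<and>
          (if \<not> set_of N \<subseteq> interior {x1..x2} then r = None
           else if 0 \<in> set_of DF then r = None
           else \<exists>F :: nat \<Rightarrow> real interval.
             (\<forall>i\<in>{1..n}. (f ^^ i) ` {x1..x2} \<subseteq> set_of (F i)) \<and>
             (if \<exists>i\<in>{1..n}. set_of (F i) \<inter> \<Delta> \<noteq> {} then r = None
              else \<exists>lmax. r = Some lmax \<and>
                (\<forall>x\<in>{x1..x2}. \<forall>d. has_iterate_deriv I \<Delta> f n x d \<longrightarrow>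
                   ln \<bar>d\<bar> / real n \<le> lmax)))))"

end

theory Submission
  imports Defs
begin

text \<open>The point \<open>x\<close> is the zero of \<open>g(x) = x - f\<^sup>n(x)\<close> produced by the interval Newton test: by the
  mean value theorem the chords from \<open>x\<^sub>0\<close> to the endpoints have slopes in \<open>G'\<^sub>x\<close>, and the containment
  of \<open>x\<^sub>0 - g(x\<^sub>0)/v\<close> in the open interval for these slopes forces \<open>g\<close> to change sign. Since \<open>x\<close> is
  interior and fixed by \<open>f\<^sup>n\<close>, a neighbourhood of \<open>x\<close> avoids \<open>\<Delta>\<close> for \<open>k n\<close> steps, for each \<open>k\<close>, so
  \<open>(f\<^sup>k\<^sup>n)'(x) = ((f\<^sup>n)'(x))\<^sup>k\<close>; comparing growth rates as \<open>k \<rightarrow> \<infinity>\<close> gives the bound on the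
  expansion exponent.\<close>

section \<open>Mean value theorem and the interval Newton test\<close>

lemma chord_slope_in:
  fixes g :: "real \<Rightarrow> real"
  assumes deriv: "\<And>x. x \<in> {c..d} \<Longrightarrow> \<exists>v\<in>V. (g has_real_derivative v) (at x within {c..d})"
    and "y \<in> {c..d}" "z \<in> {c..d}"
  shows "\<exists>v\<in>V. g y - g z = v * (y - z)"
proof -
  obtain g' where g': "\<And>x. x \<in> {c..d} \<Longrightarrow> g' x \<in> V \<and> (g has_real_derivative g' x) (at x within {c..d})"
    using deriv by metis
  \<comment> \<open>The mean value theorem needs ordered endpoints. The chord identity is unchanged
    when its endpoints are swapped, so the other order follows; chords from \<open>x0\<close> run to
    both sides.\<close>
  have ordered: "\<exists>v\<in>V. g t - g s = v * (t - s)" if "s \<le> t" "s \<in> {c..d}" "t \<in> {c..d}" for s t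
  proof -
    have sub: "{s..t} \<subseteq> {c..d}"
      using that by auto
    have "\<exists>x\<in>{s..t}. g t - g s = g' x * (t - s)"
    proof (rule mvt_very_simple[OF \<open>s \<le> t\<close>])
      fix x assume "s \<le> x" "x \<le> t"
      then have "(g has_real_derivative g' x) (at x within {s..t})"
        using g' sub by (intro DERIV_subset[OF _ sub]) auto
      then show "(g has_derivative (*) (g' x)) (at x within {s..t})"
        by (simp add: has_field_derivative_def)
    qed
    then show ?thesis
      using g' sub by blast
  qed
  show ?thesis
  proof (cases "z \<le> y")
    case True
    then show ?thesis using ordered assms by blast
  next
    case False
    then obtain v where v: "v \<in> V" "g z - g y = v * (z - y)"
      using ordered[of y z] assms by auto
    then have "g y - g z = v * (y - z)"
      by (simp add: algebra_simps)
    with v show ?thesis by blast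
  qed
qed

lemma interval_newton:
  fixes g :: "real \<Rightarrow> real"
  assumes deriv: "\<And>x. x \<in> {c..d} \<Longrightarrow> \<exists>v\<in>{p..q}. (g has_real_derivative v) (at x within {c..d})"
    and nz: "0 \<notin> {p..q}"
    and x0: "x0 \<in> {c..d}"
    and newton: "\<And>v. v \<in> {p..q} \<Longrightarrow> x0 - g x0 / v \<in> {c<..<d}"
  shows "\<exists>!x. x \<in> {c<..<d} \<and> g x = 0"
proof -
  note slope = chord_slope_in[where g=g and V="{p..q}", OF deriv]
  have nz': "v \<noteq> 0" if "v \<in> {p..q}" for v
    using nz that by metis
  obtain v1 where v1: "v1 \<in> {p..q}" "g c - g x0 = v1 * (c - x0)"
    using slope[of c x0] x0 by auto
  obtain v2 where v2: "v2 \<in> {p..q}" "g d - g x0 = v2 * (d - x0)"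
    using slope[of d x0] x0 by auto
  \<comment> \<open>\<open>s\<close> and \<open>t\<close> are the distances from the Newton points
    with slopes \<open>v1\<close> and \<open>v2\<close> to the ends \<open>c\<close> and
    \<open>d\<close>. They are positive by \<open>newton\<close>, so the signs of \<open>g c\<close>
    and \<open>g d\<close> can be read off from those of \<open>v1\<close> and \<open>v2\<close>.
    These agree, because an interval without 0 lies on one side of 0.\<close>
  define s where "s = x0 - g x0 / v1 - c"
  define t where "t = d - (x0 - g x0 / v2)"
  have "s > 0" "t > 0"
    using newton[OF v1(1)] newton[OF v2(1)] by (auto simp: s_def t_def)
  have "v1 * s = v1 * x0 - g x0 - v1 * c" "v2 * t = v2 * d - v2 * x0 + g x0"
    using nz'[OF v1(1)] nz'[OF v2(1)] by (simp_all add: s_def t_def right_diff_distrib)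
  then have gc: "g c = - v1 * s" and gd: "g d = v2 * t"
    using v1(2) v2(2) by (simp_all add: algebra_simps)
  have cont: "continuous_on {c..d} g"
    using deriv by (meson continuous_on_eq_continuous_within DERIV_continuous)
  have "\<exists>z\<in>{c..d}. g z = 0"
  proof (cases "p > 0")
    case True
    then have "g c \<le> 0" "0 \<le> g d"
      using gc gd v1 v2 \<open>s > 0\<close> \<open>t > 0\<close> by auto
    then show ?thesis
      using IVT'[of g c 0 d] cont x0 by auto
  next
    case False
    then have "q < 0"
      using nz v1 by auto
    then have "v1 \<le> 0" "v2 \<le> 0"
      using v1 v2 by auto
    then have "0 \<le> g c" "g d \<le> 0"
      using gc gd \<open>s > 0\<close> \<open>t > 0\<close> by (auto simp: mult_nonpos_nonneg)
    then show ?thesis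
      using IVT2'[of g d 0 c] cont x0 by auto
  qed
  then obtain z where z: "z \<in> {c..d}" "g z = 0"
    by blast
  \<comment> \<open>The intermediate value theorem may yield an endpoint. But since
    \<open>g z = 0\<close>, the chord from \<open>x0\<close> to \<open>z\<close> shows that
    \<open>z\<close> is itself a Newton point, hence interior.\<close>
  obtain v where v: "v \<in> {p..q}" "g z - g x0 = v * (z - x0)"
    using slope[of z x0] z x0 by auto
  then have "z = x0 - g x0 / v"
    using z nz'[of v] by (simp add: field_simps)
  then have zin: "z \<in> {c<..<d}"
    using newton v by metis
  have "w = z" if w: "w \<in> {c<..<d} \<and> g w = 0" for w
  proof -
    \<comment> \<open>A chord joining two distinct zeros would have slope 0.\<close>
    obtain u where "u \<in> {p..q}" "g w - g z = u * (w - z)"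
      using slope[of w z] z w by auto
    then show ?thesis
      using w z nz'[of u] by auto
  qed
  then show ?thesis
    using z zin by blast
qed

section \<open>Domains and derivatives of the iterates\<close>

lemma funpow_in:
  assumes "f \<in> I \<rightarrow> I" "y \<in> I"
  shows "(f ^^ i) y \<in> I"
  using assms by (induction i) auto

lemma iterate_domain_Suc_subset: "iterate_domain I \<Delta> f (Suc m) \<subseteq> iterate_domain I \<Delta> f m"
  by (auto simp: iterate_domain_def)

text \<open>Chain rule for derivatives within sets: \<open>f ^^ m\<close> maps the domain of
  \<open>Suc m\<close> steps into \<open>I - \<Delta>\<close>, so the derivative of \<open>f\<close>
  within \<open>I - \<Delta>\<close> restricts to the image and composes with the derivative of
  \<open>f ^^ m\<close> restricted to the smaller domain.\<close>

lemma iterate_differentiable: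
  assumes f: "f \<in> I \<rightarrow> I" and C1: "C1_within f (I - \<Delta>)"
    and "y \<in> iterate_domain I \<Delta> f m"
  shows "\<exists>d. ((f ^^ m) has_real_derivative d) (at y within iterate_domain I \<Delta> f m)"
  using assms(3)
proof (induction m)
  case 0
  show ?case
    by (auto intro!: exI[of _ 1] derivative_eq_intros simp: id_def)
next
  case (Suc m)
  let ?D = "iterate_domain I \<Delta> f (Suc m)"
  have maps: "(f ^^ m) ` ?D \<subseteq> I - \<Delta>"
    using funpow_in[OF f] by (auto simp: iterate_domain_def)
  obtain f' where f': "\<And>x. x \<in> I - \<Delta> \<Longrightarrow> (f has_real_derivative f' x) (at x within I - \<Delta>)"
    using C1 by (auto simp: C1_within_def)
  obtain d where "((f ^^ m) has_real_derivative d) (at y within iterate_domain I \<Delta> f m)"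
    using Suc iterate_domain_Suc_subset by blast
  then have inner: "((f ^^ m) has_real_derivative d) (at y within ?D)"
    by (rule DERIV_subset) (rule iterate_domain_Suc_subset)
  have "(f has_real_derivative f' ((f ^^ m) y)) (at ((f ^^ m) y) within (f ^^ m) ` ?D)"
    using maps Suc.prems by (intro DERIV_subset[OF f']) auto
  from DERIV_image_chain[OF this inner] show ?case
    by (auto simp: comp_def)
qed

text \<open>By continuity at the fixed point, \<open>f ^^ n\<close> sends points near
  \<open>x\<close> to points near \<open>x\<close>. A neighbourhood good for a number of rounds is
  pulled back by \<open>f ^^ n\<close> and intersected with the one good for the first round.
  Counting by \<open>Suc k\<close> starts the induction at \<open>ev\<close>.\<close>

lemma eventually_in_iterate_domain_mult:
  fixes f :: "real \<Rightarrow> real"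
  assumes ev: "\<forall>\<^sub>F y in nhds x. y \<in> iterate_domain I \<Delta> f n"
    and cont: "isCont (f ^^ n) x" and fixed: "(f ^^ n) x = x" and "n > 0"
  shows "\<forall>\<^sub>F y in nhds x. y \<in> iterate_domain I \<Delta> f (Suc k * n)"
proof (induction k)
  case 0
  then show ?case using ev by simp
next
  case (Suc k)
  have "filterlim (f ^^ n) (nhds x) (nhds x)"
    using cont fixed tendsto_at_iff_tendsto_nhds[of "f ^^ n" x] by (simp add: isCont_def)
  with Suc have "\<forall>\<^sub>F y in nhds x. (f ^^ n) y \<in> iterate_domain I \<Delta> f (Suc k * n)"
    by (rule eventually_compose_filterlim)
  with ev show ?case
  proof eventually_elim
    case (elim y)
    have "(f ^^ i) y \<notin> \<Delta>" if "i < Suc (Suc k) * n" for i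
    proof (cases "i < n")
      case True
      then show ?thesis using elim by (simp add: iterate_domain_def)
    next
      case False
      then have "(f ^^ i) y = (f ^^ (i - n)) ((f ^^ n) y)"
        by (metis comp_apply funpow_add le_add_diff_inverse2 not_less)
      then show ?thesis
        using elim that False by (simp add: iterate_domain_def)
    qed
    then show ?case
      using elim by (simp add: iterate_domain_def)
  qed
qed

lemma DERIV_funpow_fixpoint:
  fixes h :: "real \<Rightarrow> real"
  assumes "(h has_real_derivative d) (at x)" and "h x = x"
  shows "((h ^^ k) has_real_derivative d ^ k) (at x)"
proof (induction k)
  case 0
  show ?case by (simp add: id_def)
next
  case (Suc k)
  have "(h ^^ k) x = x"
    using assms(2) by (induction k) auto
  then show ?case
    using DERIV_chain[of h d "h ^^ k" x "d ^ k"] assms Suc by (simp add: comp_def)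
qed

section \<open>Growth rates along the periodic orbit\<close>

lemma exp_growth_rate_le:
  fixes l L C :: real
  assumes "C > 0" and "\<And>k. C * exp (l * real (Suc k)) \<le> exp (L * real (Suc k))"
  shows "l \<le> L"
proof (rule ccontr)
  assume "\<not> l \<le> L"
  \<comment> \<open>This \<open>k\<close> makes \<open>C * exp (k * (l - L))\<close> exceed 1, and
    passing to \<open>Suc k\<close> only increases it.\<close>
  then obtain k where "real k * (l - L) > - ln C"
    using reals_Archimedean3[of "l - L"] by (auto simp: not_le)
  moreover have "real k * (l - L) \<le> real (Suc k) * (l - L)"
    using \<open>\<not> l \<le> L\<close> by (simp add: mult_right_mono)
  moreover have "exp (ln C + l * real (Suc k)) \<le> exp (L * real (Suc k))"
    using assms by (simp add: exp_add)
  ultimately show False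
    by (simp add: algebra_simps)
qed

lemma expansion_exponent_le:
  assumes ev: "\<forall>\<^sub>F y in nhds x. y \<in> iterate_domain I \<Delta> f n"
    and deriv: "((f ^^ n) has_real_derivative d) (at x)" and "(f ^^ n) x = x" and "n > 0"
    and bound: "\<bar>d\<bar> \<le> exp (L * real n)"
    and exp: "expanding_with I \<Delta> f C l" and "C > 0"
  shows "l \<le> L"
proof -
  have "C * exp (l * real n * real (Suc k)) \<le> exp (L * real n * real (Suc k))" for k
  proof -
    let ?m = "Suc k * n"
    let ?D = "iterate_domain I \<Delta> f ?m"
    \<comment> \<open>\<open>x\<close> is interior to \<open>?D\<close>, hence a limit point of it,
      so the two-sided derivative of the iterate qualifies for
      \<open>has_iterate_deriv\<close>.\<close>
    have evD: "\<forall>\<^sub>F y in nhds x. y \<in> ?D"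
      using eventually_in_iterate_domain_mult[OF ev DERIV_isCont[OF deriv]] assms by blast
    then have D: "x \<in> ?D" "x islimpt ?D"
      using eventually_nhds_x_imp_x interior_limit_point[of x ?D]
      by (auto simp: eventually_nhds interior_def)
    have "((f ^^ ?m) has_real_derivative d ^ Suc k) (at x)"
      using DERIV_funpow_fixpoint[OF deriv, of "Suc k"] assms
      by (simp only: funpow_mult mult.commute)
    then have "has_iterate_deriv I \<Delta> f ?m x (d ^ Suc k)"
      using D by (simp add: has_iterate_deriv_def has_field_derivative_at_within)
    moreover have "?m \<ge> 1"
      using \<open>n > 0\<close> by simp
    ultimately have "C * exp (l * real ?m) \<le> \<bar>d ^ Suc k\<bar>"
      using exp D(1) unfolding expanding_with_def iterate_domain_def by blast
    also have "\<dots> \<le> exp (L * real n) ^ Suc k"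
      using power_mono[OF bound, of "Suc k"] by (simp only: power_abs)
    also have "\<dots> = exp (L * real n * real (Suc k))"
      by (simp only: exp_of_nat_mult[symmetric] mult.commute)
    finally show ?thesis
      by (simp only: of_nat_mult mult_ac)
  qed
  \<comment> \<open>The rates compared are those per period, \<open>l * n\<close> and
    \<open>L * n\<close>.\<close>
  then have "l * real n \<le> L * real n"
    by (rule exp_growth_rate_le[OF \<open>C > 0\<close>])
  then show ?thesis
    using \<open>n > 0\<close> by simp
qed

section \<open>Correctness of the algorithm\<close>

lemma PeriodicOrbit_SomeE:
  assumes "PeriodicOrbit I f \<Delta> x1 x2 n (Some lmax)"
  obtains V where
    "\<And>x d. x \<in> {x1..x2} \<Longrightarrow> has_iterate_deriv I \<Delta> f n x d \<Longrightarrow> 1 - d \<in> set_of V"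
    "0 \<notin> set_of V"
    "\<And>v. v \<in> set_of V \<Longrightarrow>
       (x1 + x2) / 2 - ((x1 + x2) / 2 - (f ^^ n) ((x1 + x2) / 2)) / v \<in> {x1<..<x2}"
    "x1 < x2"
    "\<And>i x. i \<in> {1..n} \<Longrightarrow> x \<in> {x1..x2} \<Longrightarrow> (f ^^ i) x \<notin> \<Delta>"
    "\<And>x d. x \<in> {x1..x2} \<Longrightarrow> has_iterate_deriv I \<Delta> f n x d \<Longrightarrow>
       d \<noteq> 0 \<and> ln \<bar>d\<bar> / real n \<le> lmax"
proof -
  let ?x0 = "(x1 + x2) / 2"
  let ?g = "\<lambda>x. x - (f ^^ n) x"
  \<comment> \<open>The answer \<open>Some lmax\<close> rules out every branch ending in
    \<open>None\<close>, so each test yields its negation.\<close>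
  obtain G DF DG N :: "real interval" and F :: "nat \<Rightarrow> real interval"
    where G: "?g ?x0 \<in> set_of G"
    and DF: "\<forall>x\<in>{x1..x2}. \<forall>d. has_iterate_deriv I \<Delta> f n x d \<longrightarrow> d \<in> set_of DF" "0 \<notin> set_of DF"
    and DG: "\<forall>x\<in>{x1..x2}. \<forall>d. has_iterate_deriv I \<Delta> f n x d \<longrightarrow> 1 - d \<in> set_of DG" "0 \<notin> set_of DG"
    and N: "\<forall>u\<in>set_of G. \<forall>v\<in>set_of DG. ?x0 - u / v \<in> set_of N" "set_of N \<subseteq> interior {x1..x2}"
    and F: "\<forall>i\<in>{1..n}. (f ^^ i) ` {x1..x2} \<subseteq> set_of (F i)"
      "\<forall>i\<in>{1..n}. set_of (F i) \<inter> \<Delta> = {}"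
    and lmax: "\<forall>x\<in>{x1..x2}. \<forall>d. has_iterate_deriv I \<Delta> f n x d \<longrightarrow> ln \<bar>d\<bar> / real n \<le> lmax"
    using assms unfolding PeriodicOrbit_def Let_def
    by (auto split: if_split_asm)
  \<comment> \<open>\<open>N\<close> is nonempty, so it cannot fit into the empty interior of a
    degenerate interval; this gives \<open>x1 < x2\<close>.\<close>
  have "lower N \<in> set_of N"
    by (simp add: set_of_eq)
  with N(2) have "lower N \<in> {x1<..<x2}"
    by (metis interior_atLeastAtMost_real subsetD)
  then have "x1 < x2"
    by auto
  show ?thesis
  proof (rule that[of DG])
    show "(f ^^ i) x \<notin> \<Delta>" if "i \<in> {1..n}" "x \<in> {x1..x2}" for i x
      using F that by blast
    show "?x0 - ?g ?x0 / v \<in> {x1<..<x2}" if "v \<in> set_of DG" for v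
      using N G that unfolding interior_atLeastAtMost_real by blast
    show "d \<noteq> 0 \<and> ln \<bar>d\<bar> / real n \<le> lmax"
      if "x \<in> {x1..x2}" "has_iterate_deriv I \<Delta> f n x d" for x d
      using DF lmax that by metis
  qed (use DG \<open>x1 < x2\<close> in auto)
qed

theorem proposition4:
  fixes a b x1 x2 lmax :: real
    and I \<Delta> :: "real set"
    and f :: "real \<Rightarrow> real"
    and n :: nat
  assumes "a \<le> b" and "I = {a..b}"
    and "open_interval_union \<Delta>" and "\<Delta> \<subseteq> I"
    and "f \<in> I \<rightarrow> I"
    and "C1_within f (I - \<Delta>)"
    and "x1 \<le> x2" and "{x1..x2} \<subseteq> I - \<Delta>"
    and "n > 0"
    and "PeriodicOrbit I f \<Delta> x1 x2 n (Some lmax)"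
  shows "(\<exists>!Q. \<exists>x\<in>interior {x1..x2}. periodic_orbit_through f n x Q) \<and>
    (\<forall>x\<in>interior {x1..x2}. (f ^^ n) x = x \<longrightarrow>
       (\<exists>d. has_iterate_deriv I \<Delta> f n x d \<and> \<bar>d\<bar> \<le> exp (lmax * real n))) \<and>
    (uniformly_expanding I \<Delta> f \<longrightarrow>
       (\<forall>l>0. (\<exists>C>0. expanding_with I \<Delta> f C l) \<longrightarrow> l \<le> lmax))"
proof -
  obtain V where
    V: "\<And>x d. x \<in> {x1..x2} \<Longrightarrow> has_iterate_deriv I \<Delta> f n x d \<Longrightarrow> 1 - d \<in> set_of V"
      "0 \<notin> set_of V"
      "\<And>v. v \<in> set_of V \<Longrightarrow>
         (x1 + x2) / 2 - ((x1 + x2) / 2 - (f ^^ n) ((x1 + x2) / 2)) / v \<in> {x1<..<x2}"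
    and "x1 < x2"
    and avoid: "\<And>i x. i \<in> {1..n} \<Longrightarrow> x \<in> {x1..x2} \<Longrightarrow> (f ^^ i) x \<notin> \<Delta>"
    and ln_le: "\<And>x d. x \<in> {x1..x2} \<Longrightarrow> has_iterate_deriv I \<Delta> f n x d \<Longrightarrow>
       d \<noteq> 0 \<and> ln \<bar>d\<bar> / real n \<le> lmax"
    using PeriodicOrbit_SomeE[OF assms(10)] by metis
  let ?D = "iterate_domain I \<Delta> f n"
  have sub: "{x1..x2} \<subseteq> ?D"
  proof
    fix x assume x: "x \<in> {x1..x2}"
    \<comment> \<open>The test covers times 1 to \<open>n\<close>; time 0 comes from the hypothesis
      on \<open>{x1..x2}\<close>.\<close>
    have "(f ^^ i) x \<notin> \<Delta>" if "i < n" for i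
      using avoid[of i x] x that assms(8) by (cases "i = 0") auto
    then show "x \<in> ?D"
      using x assms(8) by (auto simp: iterate_domain_def)
  qed
  have ex_deriv: "\<exists>d. has_iterate_deriv I \<Delta> f n x d" if "x \<in> {x1..x2}" for x
  proof -
    \<comment> \<open>A nondegenerate interval has no isolated points, as
      \<open>has_iterate_deriv\<close> requires.\<close>
    have "x islimpt {x1..x2}"
      using that \<open>x1 < x2\<close> by simp
    then have "x islimpt ?D"
      using islimpt_subset sub by blast
    then show ?thesis
      using iterate_differentiable[OF assms(5,6)] sub that
      by (auto simp: has_iterate_deriv_def)
  qed
  have "\<exists>!x. x \<in> {x1<..<x2} \<and> x - (f ^^ n) x = 0"
  proof (rule interval_newton[of _ _ "lower V" "upper V" _ "(x1 + x2) / 2"])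
    fix x assume x: "x \<in> {x1..x2}"
    obtain d where d: "has_iterate_deriv I \<Delta> f n x d"
      using ex_deriv[OF x] by blast
    then have "((f ^^ n) has_real_derivative d) (at x within {x1..x2})"
      using sub by (auto simp: has_iterate_deriv_def intro: DERIV_subset)
    then have "((\<lambda>x. x - (f ^^ n) x) has_real_derivative 1 - d) (at x within {x1..x2})"
      by (auto intro!: derivative_eq_intros)
    then show "\<exists>v\<in>{lower V..upper V}.
        ((\<lambda>x. x - (f ^^ n) x) has_real_derivative v) (at x within {x1..x2})"
      using V(1)[OF x d] by (auto simp: set_of_eq)
  qed (use V \<open>x1 < x2\<close> in \<open>auto simp: set_of_eq\<close>)
  moreover have "x - (f ^^ n) x = 0 \<longleftrightarrow> (f ^^ n) x = x" for x
    by auto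
  ultimately have unique_fix: "\<exists>!x. x \<in> interior {x1..x2} \<and> (f ^^ n) x = x"
    by simp
  have deriv_le: "\<bar>d\<bar> \<le> exp (lmax * real n)"
    if x: "x \<in> {x1..x2}" and d: "has_iterate_deriv I \<Delta> f n x d" for x d
  proof -
    \<comment> \<open>\<open>exp_ln\<close> undoes the logarithm only for
      \<open>d \<noteq> 0\<close> (in HOL \<open>ln 0 = 0\<close>); this is what testing 0 against
      the enclosure of the derivative supplies.\<close>
    have "ln \<bar>d\<bar> \<le> lmax * real n" "d \<noteq> 0"
      using ln_le[OF x d] \<open>n > 0\<close> by (auto simp: field_simps)
    then show ?thesis
      by (metis exp_le_cancel_iff exp_ln zero_less_abs_iff)
  qed
  have "l \<le> lmax" if "C > 0" "expanding_with I \<Delta> f C l" for C l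
  proof -
    obtain x where x: "x \<in> interior {x1..x2}" "(f ^^ n) x = x"
      using unique_fix by blast
    then have int: "x \<in> interior ?D" and xin: "x \<in> {x1..x2}"
      using interior_mono[OF sub] interior_subset by blast+
    obtain d where d: "has_iterate_deriv I \<Delta> f n x d"
      using ex_deriv[OF xin] by blast
    \<comment> \<open>At an interior point of \<open>?D\<close> the derivative within
      \<open>?D\<close> is the two-sided one, so it can be iterated at the fixed point.\<close>
    then have deriv: "((f ^^ n) has_real_derivative d) (at x)"
      using at_within_interior[OF int] by (simp add: has_iterate_deriv_def)
    have "\<forall>\<^sub>F y in nhds x. y \<in> ?D"
      using int unfolding eventually_nhds interior_def by blast
    then show ?thesis
      by (rule expansion_exponent_le[OF _ deriv x(2) \<open>n > 0\<close> deriv_le[OF xin d] that(2,1)])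
  qed
  \<comment> \<open>An orbit is determined by any of its points, so uniqueness of the fixed point
    gives uniqueness of the orbit.\<close>
  moreover have "\<exists>!Q. \<exists>x\<in>interior {x1..x2}. periodic_orbit_through f n x Q"
    using unique_fix unfolding periodic_orbit_through_def by metis
  moreover have "\<exists>d. has_iterate_deriv I \<Delta> f n x d \<and> \<bar>d\<bar> \<le> exp (lmax * real n)"
    if "x \<in> interior {x1..x2}" for x
    using that ex_deriv deriv_le interior_subset by blast
  ultimately show ?thesis
    by blast
qed

end
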